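(* Suppose $f$ is differentiable. Then $f$ is convex if and only if its domain $\mathbf{dom} f$ is convex and $$f(y) \geq f(x) + \nabla f(x)^T (y - x)$$ holds for all $x, y$ in the domain of $f$.
   Context: Here $f$ is a real-valued function of a variable in $\mathbb{R}^n$, with domain $\mathbf{dom} f \subseteq \mathbb{R}^n$, and $\nabla f(x)$ denotes its gradient at $x$. A set $C$ is convex if $\theta x_1 + (1-\theta) x_2 \in C$ for all $x_1, x_2 \in C$ and all $0 \leq \theta \leq 1$. The function $f$ is convex if $\mathbf{dom} f$ is a convex set and $f(\theta x + (1-\theta) y) \leq \theta f(x) + (1-\theta) f(y)$ for all $x, y \in \mathbf{dom} f$ and all $\theta$ with $0 \leq \theta \leq 1$. *)

theory Defs
  imports "HOL-Analysis.Analysis"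
begin

(* The library's GDERIV f x :> D is the case F = at x. For a function whose domain is a set S,
   the filter is "at x within S", so that values of the total HOL function f outside S are
   irrelevant; for x in the interior of S (in particular for open S) this is again "at x".
   If S is not open the gradient D may fail to be unique. *)
definition has_gradient ::
    "('a::real_inner \<Rightarrow> real) \<Rightarrow> 'a \<Rightarrow> 'a filter \<Rightarrow> bool"  (infix "(has'_gradient)" 50)
  where "(f has_gradient D) F \<longleftrightarrow> (f has_derivative (\<lambda>h. D \<bullet> h)) F"

end

theory Submission
  imports Defs
begin

text \<open>
  Along the segment from \<open>x\<close> to \<open>y\<close>, convexity bounds every difference quotient
  \<open>(f (x + t (y - x)) - f x) / t\<close> with \<open>0 < t \<le> 1\<close> by its value \<open>f y - f x\<close> at \<open>t = 1\<close>, and the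
  quotient tends to \<open>grad_f x \<bullet> (y - x)\<close> as \<open>t\<close> decreases to \<open>0\<close>; this is the gradient inequality
  (\<open>convex_on_imp_gradient_le\<close>). The segment stays inside the convex domain, so the
  derivative within \<open>S\<close> suffices, even if \<open>S\<close> has empty interior.

  Conversely, the gradient inequality says that at each point \<open>z\<close> of \<open>S\<close> the graph of \<open>f\<close> lies above
  an affine function touching it at \<open>z\<close>. Averaging the inequalities for two points whose convex
  combination is \<open>z\<close> cancels the linear terms and leaves the convexity inequality at \<open>z\<close>
  (\<open>convex_on_if_supporting_affine\<close>).
\<close>

text \<open>
  The chain rule along a segment: only points of \<open>S\<close> are visited, so the one-sided directional
  derivative at \<open>x\<close> exists even when \<open>x\<close> lies on the boundary.
\<close>
lemma has_gradient_along_segment: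
  fixes f :: "'a::real_inner \<Rightarrow> real"
  assumes grad: "(f has_gradient D) (at x within S)"
    and "convex S" "x \<in> S" "y \<in> S"
  shows "((\<lambda>t. f (x + t *\<^sub>R (y - x))) has_real_derivative D \<bullet> (y - x)) (at 0 within {0..1})"
proof -
  let ?p = "\<lambda>t::real. x + t *\<^sub>R (y - x)"
  have in_S: "?p ` {0..1} \<subseteq> S"
  proof
    fix z assume "z \<in> ?p ` {0..1}"
    then obtain t where t: "0 \<le> t" "t \<le> 1" and z: "z = ?p t"
      by auto
    have "z = (1 - t) *\<^sub>R x + t *\<^sub>R y"
      by (simp add: z algebra_simps)
    then show "z \<in> S"
      using convexD_alt[OF \<open>convex S\<close> \<open>x \<in> S\<close> \<open>y \<in> S\<close> t] by simp
  qed
  have "(f has_derivative (\<lambda>h. D \<bullet> h)) (at (?p 0) within ?p ` {0..1})"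
    using grad in_S by (auto simp: has_gradient_def intro: has_derivative_subset)
  moreover have "(?p has_derivative (\<lambda>h. h *\<^sub>R (y - x))) (at 0 within {0..1})"
    by (auto intro!: derivative_eq_intros)
  ultimately have "((\<lambda>t. f (?p t)) has_derivative (\<lambda>h. D \<bullet> (h *\<^sub>R (y - x)))) (at 0 within {0..1})"
    by (rule has_derivative_in_compose[rotated])
  then show ?thesis
    by (simp add: has_field_derivative_def mult_commute_abs)
qed

lemma convex_on_imp_gradient_le:
  fixes f :: "'a::real_inner \<Rightarrow> real"
  assumes conv: "convex_on S f"
    and grad: "(f has_gradient D) (at x within S)"
    and x: "x \<in> S" and y: "y \<in> S"
  shows "f x + D \<bullet> (y - x) \<le> f y"
proof -
  let ?q = "\<lambda>t::real. (f (x + t *\<^sub>R (y - x)) - f x) / t"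
  have "(?q \<longlongrightarrow> D \<bullet> (y - x)) (at 0 within {0..1})"
    using has_gradient_along_segment[OF grad convex_on_imp_convex[OF conv] x y]
    by (simp add: has_field_derivative_iff)
  moreover have "\<forall>\<^sub>F t in at 0 within {0..1}. ?q t \<le> f y - f x"
  proof -
    have "?q t \<le> f y - f x" if t: "0 < t" "t \<le> 1" for t
    proof -
      have "f (x + t *\<^sub>R (y - x)) = f ((1 - t) *\<^sub>R x + t *\<^sub>R y)"
        by (simp add: algebra_simps)
      also have "\<dots> \<le> (1 - t) * f x + t * f y"
        using convex_onD[OF conv _ _ x y, of t] t by simp
      finally show ?thesis
        using t by (simp add: divide_simps algebra_simps)
    qed
    then show ?thesis
      by (auto simp: eventually_at_filter)
  qed
  \<comment> \<open>\<open>0\<close> is a limit point of \<open>{0..1}\<close>; otherwise the limit would carry no information.\<close>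
  moreover have "at (0::real) within {0..1} \<noteq> bot"
    by (simp add: at_within_Icc_at_right)
  ultimately have "D \<bullet> (y - x) \<le> f y - f x"
    by (rule tendsto_upperbound)
  then show ?thesis
    by simp
qed

text \<open>
  With \<open>z = (1 - t) x + t y\<close>, the displacements \<open>x - z\<close> and \<open>y - z\<close> have weighted mean \<open>0\<close>, so the
  slope \<open>G z\<close> disappears from the weighted mean of the two inequalities at \<open>z\<close>.
\<close>
lemma convex_on_if_supporting_affine:
  fixes f :: "'a::real_inner \<Rightarrow> real"
  assumes "convex S"
    and support: "\<And>z w. z \<in> S \<Longrightarrow> w \<in> S \<Longrightarrow> f z + G z \<bullet> (w - z) \<le> f w"
  shows "convex_on S f"
proof (rule convex_onI[OF _ \<open>convex S\<close>])
  fix t :: real and x y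
  assume t: "0 < t" "t < 1" and x: "x \<in> S" and y: "y \<in> S"
  define z where "z = (1 - t) *\<^sub>R x + t *\<^sub>R y"
  have z: "z \<in> S"
    using convexD_alt[OF \<open>convex S\<close> x y, of t] t by (simp add: z_def)
  have "(1 - t) *\<^sub>R (x - z) + t *\<^sub>R (y - z) = 0"
    by (simp add: z_def algebra_simps)
  then have "G z \<bullet> ((1 - t) *\<^sub>R (x - z) + t *\<^sub>R (y - z)) = 0"
    by simp
  then have slope: "(1 - t) * (G z \<bullet> (x - z)) + t * (G z \<bullet> (y - z)) = 0"
    by (simp only: inner_add_right inner_scaleR_right)
  have "f z = (1 - t) * (f z + G z \<bullet> (x - z)) + t * (f z + G z \<bullet> (y - z))"
    using slope by (simp add: distrib_left left_diff_distrib)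
  also have "\<dots> \<le> (1 - t) * f x + t * f y"
    using support[OF z x] support[OF z y] t by (intro add_mono mult_left_mono) auto
  finally show "f ((1 - t) *\<^sub>R x + t *\<^sub>R y) \<le> (1 - t) * f x + t * f y"
    by (simp add: z_def)
qed

theorem theorem6:
  fixes S :: "(real ^ 'n) set"
    and f :: "real ^ 'n \<Rightarrow> real"
    and grad_f :: "real ^ 'n \<Rightarrow> real ^ 'n"
  assumes "\<forall>x\<in>S. (f has_gradient grad_f x) (at x within S)"
  shows "convex_on S f \<longleftrightarrow>
    convex S \<and> (\<forall>x\<in>S. \<forall>y\<in>S. f y \<ge> f x + grad_f x \<bullet> (y - x))"
  using assms convex_on_imp_gradient_le convex_on_if_supporting_affine[of S f grad_f]
  by (blast dest: convex_on_imp_convex)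

end
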